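(* Let $d$ and $n$ be integers with $d\ge 4$ and $n\ge 6d^2-16d+13$. Then every root $a\in\mathbb{C}$ of the Ehrhart polynomial $i(\Delta(d,n),m)$ (in the variable $m$) of the hypersimplex $\Delta(d,n)$ satisfies $\mathrm{Re}(a)<1$.
   Context: For integers $1\le d<n$, the hypersimplex $\Delta(d,n)\subset\mathbb{R}^n$ is the convex hull of the points $\mathbf{e}_{i_1}+\cdots+\mathbf{e}_{i_d}$ with $1\le i_1<\cdots<i_d\le n$, where $\mathbf{e}_j$ is the $j$-th unit coordinate vector of $\mathbb{R}^n$. For an integral convex polytope $\mathcal{P}\subset\mathbb{R}^n$ (all vertices have integer coordinates), put $i(\mathcal{P},m)=|m\mathcal{P}\cap\mathbb{Z}^n|$ for $m=1,2,\ldots$, where $m\mathcal{P}=\{m\alpha \mid \alpha\in\mathcal{P}\}$. This is a polynomial in $m$ of degree $\dim\mathcal{P}$, called the Ehrhart polynomial of $\mathcal{P}$; it is regarded as a polynomial with complex argument. For the hypersimplex it is known that $$i(\Delta(d,n),m)=\sum_{s=0}^{d-1}(-1)^s\binom{n}{s}\binom{(d-s)m+n-1-s}{n-1},$$ where $\binom{x}{n-1}=\frac{x(x-1)\cdots(x-n+2)}{(n-1)!}$. *)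

theory Defs
  imports "HOL-Analysis.Analysis" "HOL-Computational_Algebra.Polynomial"
begin

(* The ambient space R^n is real ^ 'n with n = CARD('n).  A choice of indices
   i_1 < ... < i_d is the same as a d-element subset I of 'n. *)
definition hypersimplex :: "nat \<Rightarrow> (real ^ 'n) set" where
  "hypersimplex d = convex hull {\<Sum>i\<in>I. axis i 1 | I. card I = d}"

definition lattice_points :: "(real ^ 'n) set" where
  "lattice_points = {x. \<forall>i. x $ i \<in> \<int>}"

definition ehrhart_count :: "(real ^ 'n) set \<Rightarrow> nat \<Rightarrow> nat" where
  "ehrhart_count P m = card ((\<lambda>x. real m *\<^sub>R x) ` P \<inter> lattice_points)"

(* Existence holds for integral convex polytopes (Ehrhart); uniqueness always holds.
   For other sets P the value is unspecified.  The coefficients are taken in the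
   complex numbers so that the argument may be complex. *)
definition ehrhart_polynomial :: "(real ^ 'n) set \<Rightarrow> complex poly" where
  "ehrhart_polynomial P =
     (THE p. \<forall>m\<ge>1. poly p (of_nat m) = of_nat (ehrhart_count P m))"

lemma ehrhart_polynomial_eqI:
  assumes "\<And>m. m \<ge> 1 \<Longrightarrow> poly p (of_nat m) = of_nat (ehrhart_count P m)"
  shows "ehrhart_polynomial P = p"
  unfolding ehrhart_polynomial_def
proof (rule the_equality)
  show "\<forall>m\<ge>1. poly p (of_nat m) = of_nat (ehrhart_count P m)"
    using assms by blast
next
  fix q :: "complex poly"
  assume q: "\<forall>m\<ge>1. poly q (of_nat m) = of_nat (ehrhart_count P m)"
  show "q = p"
  proof (rule ccontr)
    assume "q \<noteq> p"
    then have fin: "finite {x. poly (q - p) x = 0}"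
      by (intro poly_roots_finite) simp
    have "(of_nat ` {1::nat..} :: complex set) \<subseteq> {x. poly (q - p) x = 0}"
      using q assms by auto
    with fin have "finite (of_nat ` {1::nat..} :: complex set)"
      by (rule rev_finite_subset)
    then have "finite {1::nat..}"
      by (rule finite_imageD) (simp add: inj_on_def)
    then show False
      by (simp add: infinite_Ici)
  qed
qed

end

theory Submission
  imports Defs
begin

text \<open>
  Write the Ehrhart polynomial of the hypersimplex as an alternating sum of terms
  \<open>T 0, ..., T (d - 1)\<close>, where \<open>T s\<close> carries the factor \<open>(- 1) ^ s\<close> and the binomial
  coefficient \<open>n choose s\<close>. In the half-plane \<open>Re z \<ge> 1\<close> the term \<open>T 0\<close> is nonzero and
  strictly dominates the sum of all the others, so there is no root there.

  For the formula itself, the lattice points of the \<open>m\<close>-th dilate are the integer vectors with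
  entries between \<open>0\<close> and \<open>m\<close> and entry sum \<open>d * m\<close>
  (\<open>hypersimplex_lattice_points\<close>); their number is a coefficient of the power series
  \<open>((1 - X ^ (m + 1)) / (1 - X)) ^ n\<close>, and expanding numerator and denominator gives the
  alternating sum (\<open>card_box_slice\<close>, \<open>poly_hypersimplex_ehrhart_polynomial\<close>).

  For the domination, up to sign and the factor \<open>n choose s\<close> the quotient of \<open>T s\<close> by \<open>T 0\<close> is the
  product over \<open>1 \<le> k < n\<close> of \<open>((d - s) * z - s + k) / (d * z + k)\<close>. How large a factor can
  get depends on \<open>k\<close>. For \<open>k < d\<close> its modulus is at most \<open>1 - 1 / d\<close>, whatever \<open>s \<ge> 1\<close> is,
  so these factors together contribute at most \<open>(1 - 1 / d) ^ (d - 1) \<le> 1 / 2\<close>. For \<open>k \<ge> d\<close>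
  the modulus is largest at \<open>z = 1\<close>, and the product
  of the values there telescopes to \<open>(2 * d - 1 choose 2 * s) / (n + d - 1 choose 2 * s)\<close>.
  As soon as \<open>n \<ge> 4 * d\<^sup>2 - 7 * d + 4\<close>, this times \<open>n choose s\<close> is at most
  \<open>1 / fact s\<close> (\<open>binomial_tail_ratio_le\<close>). Hence the modulus of \<open>T s\<close> is at most
  \<open>1 / 2 ^ s\<close> times that of \<open>T 0\<close>, and summing over \<open>1 \<le> s < d\<close> leaves a factor below one.
\<close>

section \<open>Lattice points in dilated hypersimplices\<close>

text \<open>
  Peel off one \<open>d\<close>-set at a time. The set has to contain every index where \<open>f\<close> attains the
  bound, so that the rest fits into the smaller box, and it has to stay inside the support of \<open>f\<close>.
  Since the sum is \<open>d\<close> times the bound, at most \<open>d\<close> indices are forced and at least \<open>d\<close> are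
  available.
\<close>
lemma box_slice_sum_of_subset_indicators:
  fixes f :: "'n::finite \<Rightarrow> nat"
  assumes "\<And>i. f i \<le> m" and "(\<Sum>i\<in>UNIV. f i) = d * m"
  shows "\<exists>F. (\<forall>t<m. card (F t) = d) \<and> (\<forall>i. f i = (\<Sum>t<m. if i \<in> F t then 1 else 0))"
  using assms
proof (induction m arbitrary: f)
  case 0
  then show ?case by simp
next
  case (Suc m)
  define A where "A = {i. f i = Suc m}"
  define B where "B = {i. f i \<ge> 1}"
  have "card A * Suc m = (\<Sum>i\<in>A. f i)"
    by (simp add: A_def)
  also have "\<dots> \<le> (\<Sum>i\<in>UNIV. f i)"
    by (intro sum_mono2) auto
  finally have A: "card A \<le> d"
    unfolding Suc.prems(2) by (simp del: mult_Suc_right)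
  have "d * Suc m = (\<Sum>i\<in>B. f i)"
    unfolding Suc.prems(2)[symmetric]
    by (intro sum.mono_neutral_right) (auto simp: B_def)
  also have "\<dots> \<le> card B * Suc m"
    using sum_bounded_above[of B f "Suc m"] Suc.prems(1) by simp
  finally have B: "d \<le> card B"
    by (simp del: mult_Suc_right)
  have "A \<subseteq> B"
    by (auto simp: A_def B_def)
  with A B obtain I where I: "A \<subseteq> I" "I \<subseteq> B" "card I = d"
    using exists_subset_between[of A d B] by auto
  define g where "g i = f i - (if i \<in> I then 1 else 0)" for i
  have fg: "f i = g i + (if i \<in> I then 1 else 0)" for i
    using I by (auto simp: g_def B_def)
  have "g i \<le> m" for i
    using Suc.prems(1)[of i] I(1) by (cases "f i = Suc m") (auto simp: g_def A_def)
  moreover have "(\<Sum>i\<in>UNIV. g i) = d * m"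
  proof -
    have "(\<Sum>i\<in>UNIV. f i) = (\<Sum>i\<in>UNIV. g i) + card I"
      by (simp add: fg sum.distrib flip: sum.inter_filter)
    with Suc.prems(2) I show ?thesis by simp
  qed
  ultimately obtain F where F: "\<forall>t<m. card (F t) = d"
    "\<forall>i. g i = (\<Sum>t<m. if i \<in> F t then 1 else 0)"
    using Suc.IH by blast
  have "\<forall>t<Suc m. card ((F(m := I)) t) = d"
    using F I by (auto simp: less_Suc_eq)
  moreover have "\<forall>i. f i = (\<Sum>t<Suc m. if i \<in> (F(m := I)) t then 1 else 0)"
    using F(2) by (simp add: fg)
  ultimately show ?case by blast
qed

lemma vertex_component:
  fixes I :: "'n::finite set"
  shows "(\<Sum>j\<in>I. axis j (1::real) $ i) = (if i \<in> I then 1 else 0)"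
  by (simp add: axis_def if_distrib cong: if_cong)

lemma hypersimplex_subset_slice:
  fixes x :: "real ^ 'n"
  assumes "x \<in> hypersimplex d"
  shows "0 \<le> x $ i" and "x $ i \<le> 1" and "(\<Sum>i\<in>UNIV. x $ i) = real d"
proof -
  let ?K = "{x :: real ^ 'n. (\<forall>i. 0 \<le> x $ i \<and> x $ i \<le> 1) \<and> (\<Sum>i\<in>UNIV. x $ i) = real d}"
  have "convex ?K"
  proof (rule convexI)
    fix x y :: "real ^ 'n" and u v :: real
    assume x: "x \<in> ?K" and y: "y \<in> ?K" and uv: "0 \<le> u" "0 \<le> v" "u + v = 1"
    have "u * x $ i + v * y $ i \<le> 1" for i
    proof -
      have "u * x $ i + v * y $ i \<le> u * 1 + v * 1"
        using x y uv by (intro add_mono mult_left_mono) auto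
      with uv show ?thesis by simp
    qed
    moreover have "(\<Sum>i\<in>UNIV. u * x $ i + v * y $ i) = real d"
    proof -
      have "(\<Sum>i\<in>UNIV. u * x $ i + v * y $ i) = u * real d + v * real d"
        using x y by (simp add: sum.distrib flip: sum_distrib_left)
      with uv show ?thesis by (simp flip: distrib_right)
    qed
    ultimately show "u *\<^sub>R x + v *\<^sub>R y \<in> ?K"
      using x y uv by simp
  qed
  moreover have "{\<Sum>i\<in>I. axis i 1 | I. card I = d} \<subseteq> ?K"
  proof clarify
    fix I :: "'n set" assume "d = card I"
    then show "(\<forall>i. 0 \<le> (\<Sum>i\<in>I. axis i (1::real)) $ i \<and> (\<Sum>i\<in>I. axis i (1::real)) $ i \<le> 1) \<and>
        (\<Sum>i\<in>UNIV. (\<Sum>i\<in>I. axis i (1::real)) $ i) = real (card I)"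
      unfolding sum_component vertex_component by (simp flip: sum.inter_filter)
  qed
  ultimately have "hypersimplex d \<subseteq> ?K"
    unfolding hypersimplex_def by (rule hull_minimal[rotated])
  with assms show "0 \<le> x $ i" "x $ i \<le> 1" "(\<Sum>i\<in>UNIV. x $ i) = real d"
    by auto
qed

text \<open>
  The nontrivial inclusion is the integer decomposition property: a lattice point of the dilate is
  a sum of \<open>m\<close> vertices, so dividing by \<open>m\<close> exhibits a convex combination with equal weights.
\<close>
lemma hypersimplex_lattice_points:
  assumes "m \<ge> 1"
  shows "(\<lambda>x. real m *\<^sub>R x) ` (hypersimplex d :: (real ^ 'n) set) \<inter> lattice_points =
    (\<lambda>f. \<chi> i. real (f i)) ` {f :: 'n \<Rightarrow> nat. (\<forall>i. f i \<le> m) \<and> (\<Sum>i\<in>UNIV. f i) = d * m}"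
    (is "?L = ?R")
proof
  show "?L \<subseteq> ?R"
  proof
    fix y assume "y \<in> ?L"
    then obtain x :: "real ^ 'n" where x: "x \<in> hypersimplex d" "y = real m *\<^sub>R x"
      and int: "\<forall>i. y $ i \<in> \<int>"
      by (auto simp: lattice_points_def)
    define f where "f i = nat \<lfloor>y $ i\<rfloor>" for i
    have f: "real (f i) = y $ i" for i
    proof -
      have "y $ i \<in> \<int>" "0 \<le> y $ i"
        using int hypersimplex_subset_slice(1)[OF x(1), of i] x(2) by simp_all
      then show ?thesis by (auto simp: f_def elim: Ints_cases)
    qed
    have "real (f i) \<le> real m" for i
      unfolding f x(2) using hypersimplex_subset_slice(2)[OF x(1), of i]
      by (simp add: mult_left_le)
    moreover have "real (\<Sum>i\<in>UNIV. f i) = real (d * m)"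
      by (simp add: f x hypersimplex_subset_slice(3) flip: sum_distrib_left)
    ultimately have "f \<in> {f. (\<forall>i. f i \<le> m) \<and> (\<Sum>i\<in>UNIV. f i) = d * m}"
      by (simp only: of_nat_le_iff of_nat_eq_iff mem_Collect_eq simp_thms)
    moreover have "y = (\<chi> i. real (f i))"
      by (simp add: vec_eq_iff f)
    ultimately show "y \<in> ?R" by blast
  qed
next
  show "?R \<subseteq> ?L"
  proof clarify
    fix f :: "'n \<Rightarrow> nat"
    assume "\<forall>i. f i \<le> m" "(\<Sum>i\<in>UNIV. f i) = d * m"
    then obtain F where F: "\<forall>t<m. card (F t) = d"
      "\<forall>i. f i = (\<Sum>t<m. if i \<in> F t then 1 else 0)"
      using box_slice_sum_of_subset_indicators by blast
    define x :: "real ^ 'n" where "x = (\<Sum>t<m. (1 / real m) *\<^sub>R (\<Sum>i\<in>F t. axis i 1))"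
    have "x \<in> hypersimplex d"
      unfolding x_def hypersimplex_def
      using F(1) assms by (intro convex_sum) (auto intro!: hull_inc)
    moreover have "(\<chi> i. real (f i)) = real m *\<^sub>R x"
      using assms
      by (simp add: vec_eq_iff x_def F(2) vertex_component sum_distrib_left of_nat_sum
          if_distrib cong: if_cong)
    moreover have "(\<chi> i. real (f i)) \<in> lattice_points"
      by (simp add: lattice_points_def)
    ultimately show "(\<chi> i. real (f i)) \<in> ?L" by blast
  qed
qed

section \<open>The alternating sum for the Ehrhart polynomial\<close>

text \<open>
  Both sides are the coefficient of \<open>X ^ k\<close> in \<open>(1 + X + ... + X ^ m) ^ n\<close>: multiplying out
  the \<open>n\<close> factors enumerates the functions, while the closed form
  \<open>(1 - X ^ (m + 1)) ^ n * (1 - X) ^ (- n)\<close> produces the alternating sum.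
\<close>
lemma card_box_slice:
  fixes m k :: nat
  shows "of_nat (card {f :: 'n::finite \<Rightarrow> nat. (\<forall>i. f i \<le> m) \<and> (\<Sum>i\<in>UNIV. f i) = k}) =
    (\<Sum>s\<in>{s. s \<le> CARD('n) \<and> s * Suc m \<le> k}.
       (-1) ^ s * of_nat (CARD('n) choose s) * of_nat (CARD('n) + (k - s * Suc m) - 1 choose (CARD('n) - 1)) :: complex)"
proof -
  let ?n = "CARD('n)"
  let ?X = "fps_X :: complex fps"
  let ?P = "\<Sum>j\<le>m. ?X ^ j"
  have "?P ^ ?n = (\<Prod>i\<in>(UNIV::'n set). ?P)"
    by simp
  also have "\<dots> = (\<Sum>f\<in>(UNIV::'n set) \<rightarrow>\<^sub>E {..m}. \<Prod>i\<in>UNIV. ?X ^ f i)"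
    by (intro prod_sum_PiE) auto
  also have "\<dots> = (\<Sum>f\<in>(UNIV::'n set) \<rightarrow>\<^sub>E {..m}. ?X ^ (\<Sum>i\<in>UNIV. f i))"
    by (simp add: power_sum)
  finally have "fps_nth (?P ^ ?n) k =
      (\<Sum>f\<in>(UNIV::'n set) \<rightarrow>\<^sub>E {..m}. if k = (\<Sum>i\<in>UNIV. f i) then 1 else 0)"
    by (simp add: fps_sum_nth fps_X_power_nth)
  also have "\<dots> = of_nat (card {f \<in> (UNIV::'n set) \<rightarrow>\<^sub>E {..m}. k = (\<Sum>i\<in>UNIV. f i)})"
    by (subst sum.inter_filter[symmetric]) (auto intro: finite_PiE)
  also have "{f \<in> (UNIV::'n set) \<rightarrow>\<^sub>E {..m}. k = (\<Sum>i\<in>UNIV. f i)} =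
      {f. (\<forall>i. f i \<le> m) \<and> (\<Sum>i\<in>UNIV. f i) = k}"
    by (auto simp: PiE_def)
  finally have card: "fps_nth (?P ^ ?n) k =
      of_nat (card {f :: 'n \<Rightarrow> nat. (\<forall>i. f i \<le> m) \<and> (\<Sum>i\<in>UNIV. f i) = k})" .

  have unit: "fps_nth ((1 - ?X) ^ ?n) 0 \<noteq> 0"
    by (simp add: fps_nth_power_0)
  have "(1 - ?X) * ?P = 1 - ?X ^ Suc m"
    using one_diff_power_eq[of ?X "Suc m"] by (simp add: lessThan_Suc_atMost)
  then have "?P ^ ?n * (1 - ?X) ^ ?n = (1 - ?X ^ Suc m) ^ ?n"
    by (metis mult.commute power_mult_distrib)
  then have "(1 - ?X ^ Suc m) ^ ?n * inverse ((1 - ?X) ^ ?n) =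
      ?P ^ ?n * ((1 - ?X) ^ ?n * inverse ((1 - ?X) ^ ?n))"
    by (simp only: mult.assoc[symmetric])
  then have "?P ^ ?n = (1 - ?X ^ Suc m) ^ ?n * inverse ((1 - ?X) ^ ?n)"
    by (simp only: inverse_mult_eq_1'[OF unit] mult_1_right)
  also have "inverse ((1 - ?X) ^ ?n) = Abs_fps (\<lambda>j. of_nat (?n + j - 1 choose j))"
    using one_minus_const_fps_X_neg_power'[of ?n "1::complex"] by simp
  also have "(1 - ?X ^ Suc m) ^ ?n = (\<Sum>s\<le>?n. of_nat (?n choose s) * (- (?X ^ Suc m)) ^ s)"
    using binomial_ring[of "- (?X ^ Suc m)" 1 ?n] by simp
  also have "\<dots> = (\<Sum>s\<le>?n. fps_const ((-1) ^ s * of_nat (?n choose s)) * ?X ^ (s * Suc m))"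
  proof (intro sum.cong refl)
    fix s
    have "(- (?X ^ Suc m)) ^ s = fps_const ((-1) ^ s) * ?X ^ (s * Suc m)"
      by (subst power_minus) (simp add: power_mult[symmetric] mult.commute fps_const_power[symmetric] del: fps_const_power power_Suc mult_Suc mult_Suc_right)
    then show "of_nat (?n choose s) * (- (?X ^ Suc m)) ^ s =
        fps_const ((-1) ^ s * of_nat (?n choose s)) * ?X ^ (s * Suc m)"
      by (simp add: fps_of_nat[symmetric] mult_ac flip: fps_const_mult)
  qed
  finally have "fps_nth (?P ^ ?n) k = (\<Sum>s\<le>?n. (-1) ^ s * of_nat (?n choose s) *
      (if k < s * Suc m then 0 else of_nat (?n + (k - s * Suc m) - 1 choose (k - s * Suc m))))"
    by (simp add: sum_distrib_right fps_sum_nth mult.assoc fps_X_power_mult_nth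
        del: mult_Suc mult_Suc_right cong: if_cong)
  also have "\<dots> = (\<Sum>s\<in>{s. s \<le> ?n \<and> s * Suc m \<le> k}. (-1) ^ s * of_nat (?n choose s) *
      of_nat (?n + (k - s * Suc m) - 1 choose (k - s * Suc m)))"
    by (intro sum.mono_neutral_cong_right) auto
  also have "\<dots> = (\<Sum>s\<in>{s. s \<le> ?n \<and> s * Suc m \<le> k}. (-1) ^ s * of_nat (?n choose s) *
      of_nat (?n + (k - s * Suc m) - 1 choose (?n - 1)))"
  proof (intro sum.cong refl)
    fix s
    have "?n > 0" by simp
    then have "(?n + (k - s * Suc m) - 1 choose (k - s * Suc m)) = (?n + (k - s * Suc m) - 1 choose (?n - 1))"
      by (subst binomial_symmetric) (auto simp del: mult_Suc mult_Suc_right zero_less_card_finite)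
    then show "(-1) ^ s * of_nat (?n choose s) * of_nat (?n + (k - s * Suc m) - 1 choose (k - s * Suc m)) =
      (-1) ^ s * of_nat (?n choose s) * (of_nat (?n + (k - s * Suc m) - 1 choose (?n - 1)) :: complex)"
      by simp
  qed
  finally show ?thesis unfolding card .
qed

text \<open>
  The generalised binomial coefficient is a polynomial in the upper argument, so the summation range
  must not depend on \<open>m\<close>. This is possible because the terms with \<open>(d - s) * m < s < d\<close> vanish:
  their upper argument is a natural number smaller than \<open>n - 1\<close>.
\<close>
lemma hypersimplex_ehrhart_count:
  assumes "1 \<le> d" and "d \<le> CARD('n)" and "m \<ge> 1"
  shows "of_nat (ehrhart_count (hypersimplex d :: (real ^ 'n) set) m) =
    (\<Sum>s<d. (-1) ^ s * of_nat (CARD('n) choose s) *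
       (((of_nat d - of_nat s) * of_nat m + of_nat (CARD('n) - 1) - of_nat s :: complex) gchoose (CARD('n) - 1)))"
proof -
  let ?n = "CARD('n)"
  let ?S = "{s. s \<le> ?n \<and> s * Suc m \<le> d * m}"
  have "inj (\<lambda>f :: 'n \<Rightarrow> nat. \<chi> i. real (f i))"
    by (auto simp: inj_on_def vec_eq_iff)
  then have "ehrhart_count (hypersimplex d :: (real ^ 'n) set) m =
      card {f :: 'n \<Rightarrow> nat. (\<forall>i. f i \<le> m) \<and> (\<Sum>i\<in>UNIV. f i) = d * m}"
    unfolding ehrhart_count_def hypersimplex_lattice_points[OF assms(3)]
    by (intro card_image) (auto intro: inj_on_subset)
  then have "of_nat (ehrhart_count (hypersimplex d :: (real ^ 'n) set) m) =
     (\<Sum>s\<in>?S. (-1) ^ s * of_nat (?n choose s) * of_nat (?n + (d * m - s * Suc m) - 1 choose (?n - 1)) :: complex)"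
    using card_box_slice[where 'n='n] by simp
  also have "\<dots> = (\<Sum>s<d. (-1) ^ s * of_nat (?n choose s) *
       (((of_nat d - of_nat s) * of_nat m + of_nat (?n - 1) - of_nat s :: complex) gchoose (?n - 1)))"
  proof (rule sum.mono_neutral_cong_left)
    show "?S \<subseteq> {..<d}"
    proof
      fix s assume s: "s \<in> ?S"
      show "s \<in> {..<d}"
      proof (rule ccontr)
        assume "s \<notin> {..<d}"
        then have "d * Suc m \<le> s * Suc m" by (intro mult_le_mono1) simp
        with s assms(1) show False by simp
      qed
    qed
  next
    fix s assume s: "s \<in> ?S"
    then obtain j where j: "d * m = s * Suc m + j"
      using le_Suc_ex by blast
    have "of_nat (d * m) = (of_nat (s * Suc m + j) :: complex)"
      by (simp only: j)
    then have "of_nat (N + j) =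
        ((of_nat d - of_nat s) * of_nat m + of_nat N - of_nat s :: complex)" for N
      by (simp add: algebra_simps)
    moreover have "?n + (d * m - s * Suc m) - 1 = ?n - 1 + j"
      unfolding j by (simp add: Suc_leI)
    ultimately have "of_nat (?n + (d * m - s * Suc m) - 1) =
        ((of_nat d - of_nat s) * of_nat m + of_nat (?n - 1) - of_nat s :: complex)"
      by (simp only:)
    then show "(-1) ^ s * of_nat (?n choose s) * of_nat (?n + (d * m - s * Suc m) - 1 choose (?n - 1)) =
      (-1) ^ s * of_nat (?n choose s) *
       (((of_nat d - of_nat s) * of_nat m + of_nat (?n - 1) - of_nat s :: complex) gchoose (?n - 1))"
      by (simp add: binomial_gbinomial)
  next
    show "\<forall>s\<in>{..<d} - ?S. (-1) ^ s * of_nat (?n choose s) *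
       (((of_nat d - of_nat s) * of_nat m + of_nat (?n - 1) - of_nat s :: complex) gchoose (?n - 1)) = 0"
    proof
      fix s assume "s \<in> {..<d} - ?S"
      with assms have s: "s < d" "d * m < s * Suc m" by auto
      then have le: "(d - s) * m < s"
        using mult_le_mono1[of s d m] unfolding diff_mult_distrib mult_Suc_right by linarith
      have "s \<le> ?n - 1" using s assms by linarith
      have "of_nat ((d - s) * m + N - s) =
        ((of_nat d - of_nat s) * of_nat m + of_nat N - of_nat s :: complex)" if "s \<le> N" for N
        using s that by (simp add: of_nat_diff trans_le_add2)
      from this[OF \<open>s \<le> ?n - 1\<close>] have "of_nat ((d - s) * m + (?n - 1) - s) =
        ((of_nat d - of_nat s) * of_nat m + of_nat (?n - 1) - of_nat s :: complex)" .
      moreover have "(d - s) * m + (?n - 1) - s < ?n - 1"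
        using le \<open>s \<le> ?n - 1\<close> by linarith
      ultimately show "(-1) ^ s * of_nat (?n choose s) *
       (((of_nat d - of_nat s) * of_nat m + of_nat (?n - 1) - of_nat s :: complex) gchoose (?n - 1)) = 0"
        by (metis binomial_eq_0 binomial_gbinomial mult_zero_right of_nat_0)
    qed
  qed auto
  finally show ?thesis .
qed

lemma poly_hypersimplex_ehrhart_polynomial:
  assumes "1 \<le> d" and "d \<le> CARD('n)"
  shows "poly (ehrhart_polynomial (hypersimplex d :: (real ^ 'n) set)) z =
    (\<Sum>s<d. (-1) ^ s * of_nat (CARD('n) choose s) *
       (((of_nat d - of_nat s) * z + of_nat (CARD('n) - 1) - of_nat s) gchoose (CARD('n) - 1)))"
proof -
  let ?N = "CARD('n) - 1"
  define p :: "complex poly" where "p = (\<Sum>s<d. smult ((-1) ^ s * of_nat (CARD('n) choose s) / fact ?N)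
      (\<Prod>i=0..<?N. [: of_nat ?N - of_nat s - of_nat i, of_nat d - of_nat s :]))"
  have p: "poly p z = (\<Sum>s<d. (-1) ^ s * of_nat (CARD('n) choose s) *
      (((of_nat d - of_nat s) * z + of_nat ?N - of_nat s) gchoose ?N))" for z
    unfolding p_def by (simp add: poly_sum poly_prod gbinomial_prod_rev algebra_simps)
  have "ehrhart_polynomial (hypersimplex d :: (real ^ 'n) set) = p"
    by (rule ehrhart_polynomial_eqI) (simp add: p hypersimplex_ehrhart_count[OF assms] del: One_nat_def)
  then show ?thesis using p by simp
qed

section \<open>Domination by the leading term for real part at least one\<close>

lemma norm_le_of_Re_Im_le:
  assumes "0 \<le> c" and "\<bar>Re u\<bar> \<le> c * \<bar>Re v\<bar>" and "\<bar>Im u\<bar> \<le> c * \<bar>Im v\<bar>"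
  shows "norm u \<le> c * norm v"
proof -
  have "(Re u)\<^sup>2 + (Im u)\<^sup>2 \<le> (c * \<bar>Re v\<bar>)\<^sup>2 + (c * \<bar>Im v\<bar>)\<^sup>2"
    using assms by (intro add_mono abs_le_square_iff[THEN iffD1]) (auto simp: abs_mult)
  also have "\<dots> = c\<^sup>2 * ((Re v)\<^sup>2 + (Im v)\<^sup>2)"
    by (simp add: power_mult_distrib algebra_simps)
  finally have "norm u \<le> sqrt (c\<^sup>2 * ((Re v)\<^sup>2 + (Im v)\<^sup>2))"
    unfolding cmod_def by (rule real_sqrt_le_mono)
  then show ?thesis
    using assms(1) by (simp add: cmod_def real_sqrt_mult)
qed

text \<open>
  The real part of the left-hand number is largest for \<open>s = 1\<close>, where it is
  \<open>(d - 1) * Re z + k - 1\<close>. For \<open>s > k\<close> it may be negative, but then its modulus is at most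
  \<open>d - 2\<close>, which \<open>(d - 1) * Re z\<close> exceeds.
\<close>
lemma factor_ratio_small_index:
  fixes z :: complex
  assumes z: "Re z \<ge> 1" and s: "1 \<le> s" "s < d" and k: "1 \<le> k" "k \<le> d"
  shows "norm ((of_nat d - of_nat s) * z - of_nat s + of_nat k) \<le>
    (1 - 1 / real d) * norm (of_nat d * z + of_nat k)"
proof (rule norm_le_of_Re_Im_le)
  show "0 \<le> 1 - 1 / real d" using s by simp
  have r: "real k \<le> real d" "1 \<le> real s" "real s + 1 \<le> real d" "1 \<le> real k" using s k by linarith+
  have dz: "0 \<le> Re (of_nat d * z + of_nat k)" using z by simp
  have R: "(1 - 1 / real d) * Re (of_nat d * z + of_nat k) = (real d - 1) * Re z + real k - real k / real d"
    using r by (simp add: field_simps)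
  have kd: "real k / real d \<le> 1" using r by simp
  have "real s * (Re z + 1) \<ge> 1 * (Re z + 1)"
    using r z by (intro mult_right_mono) auto
  then have "(real d - real s) * Re z - real s + real k \<le> (real d - 1) * Re z + real k - real k / real d"
    using kd by (simp add: algebra_simps)
  moreover have "- ((real d - real s) * Re z - real s + real k) \<le> (real d - 1) * Re z + real k - real k / real d"
  proof -
    have "(real d - real s) * Re z \<ge> 0" using r z by simp
    moreover have "(real d - 1) * Re z \<ge> (real d - 1) * 1" using r z by (intro mult_left_mono) auto
    ultimately show ?thesis using kd r unfolding left_diff_distrib by linarith
  qed
  ultimately show "\<bar>Re ((of_nat d - of_nat s) * z - of_nat s + of_nat k)\<bar> \<le>
      (1 - 1 / real d) * \<bar>Re (of_nat d * z + of_nat k)\<bar>"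
    unfolding abs_of_nonneg[OF dz] R by simp
  have "(real d - real s) * \<bar>Im z\<bar> \<le> (real d - 1) * \<bar>Im z\<bar>"
    using r by (intro mult_right_mono) auto
  then show "\<bar>Im ((of_nat d - of_nat s) * z - of_nat s + of_nat k)\<bar> \<le>
      (1 - 1 / real d) * \<bar>Im (of_nat d * z + of_nat k)\<bar>"
  proof -
    have "\<bar>Im ((of_nat d - of_nat s) * z - of_nat s + of_nat k)\<bar> = (real d - real s) * \<bar>Im z\<bar>"
      using r by (simp add: abs_mult)
    moreover have "(1 - 1 / real d) * \<bar>Im (of_nat d * z + of_nat k)\<bar> = (real d - 1) * \<bar>Im z\<bar>"
      using r by (simp add: abs_mult field_simps)
    ultimately show ?thesis
      using \<open>(real d - real s) * \<bar>Im z\<bar> \<le> (real d - 1) * \<bar>Im z\<bar>\<close> by simp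
  qed
qed

text \<open>
  The constant is the value of the ratio at \<open>z = 1\<close>. For \<open>k \<ge> d\<close> the ratio does not
  increase along the real axis to the right of \<open>1\<close>, and it tends to \<open>(d - s) / d\<close>, which is also
  the ratio of the imaginary parts.
\<close>
lemma factor_ratio_large_index:
  fixes z :: complex
  assumes z: "Re z \<ge> 1" and s: "s < d" and k: "d \<le> k"
  shows "norm ((of_nat d - of_nat s) * z - of_nat s + of_nat k) \<le>
    ((real d + real k - 2 * real s) / (real d + real k)) * norm (of_nat d * z + of_nat k)"
proof (rule norm_le_of_Re_Im_le)
  have r: "real d \<le> real k" "0 \<le> real s" "real s < real d" using s k by linarith+
  show "0 \<le> (real d + real k - 2 * real s) / (real d + real k)" using r by simp
  have dz: "0 \<le> Re (of_nat d * z + of_nat k)" using z by simp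
  have "(real d - real s) * Re z - real s + real k \<ge> 0"
  proof -
    have "0 \<le> (real d - real s) * Re z" using r z by simp
    then show ?thesis using r by linarith
  qed
  moreover have "((real d - real s) * Re z - real s + real k) * (real d + real k) \<le>
      (real d + real k - 2 * real s) * (real d * Re z + real k)"
  proof -
    have "(real d + real k - 2 * real s) * (real d * Re z + real k) -
        ((real d - real s) * Re z - real s + real k) * (real d + real k) =
        real s * (real k - real d) * (Re z - 1)"
      by (simp add: algebra_simps)
    moreover have "\<dots> \<ge> 0" using r z by simp
    ultimately show ?thesis by linarith
  qed
  ultimately show "\<bar>Re ((of_nat d - of_nat s) * z - of_nat s + of_nat k)\<bar> \<le>
      (real d + real k - 2 * real s) / (real d + real k) * \<bar>Re (of_nat d * z + of_nat k)\<bar>"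
    unfolding abs_of_nonneg[OF dz] using r by (simp add: pos_le_divide_eq)
  have "(real d - real s) * (real d + real k) \<le> (real d + real k - 2 * real s) * real d"
  proof -
    have "(real d + real k - 2 * real s) * real d - (real d - real s) * (real d + real k) =
      real s * (real k - real d)" by (simp add: algebra_simps)
    moreover have "\<dots> \<ge> 0" using r by simp
    ultimately show ?thesis by linarith
  qed
  from mult_right_mono[OF this, of "\<bar>Im z\<bar>"]
  show "\<bar>Im ((of_nat d - of_nat s) * z - of_nat s + of_nat k)\<bar> \<le>
      (real d + real k - 2 * real s) / (real d + real k) * \<bar>Im (of_nat d * z + of_nat k)\<bar>"
    using r by (simp add: abs_mult pos_le_divide_eq mult_ac)
qed

text \<open>
  For \<open>d \<le> n\<close> and \<open>s < d\<close> this product equals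
  \<open>(2 * d - 1 choose 2 * s) / (n + d - 1 choose 2 * s)\<close>; the product form avoids
  truncated subtraction.
\<close>
definition tail_ratio :: "nat \<Rightarrow> nat \<Rightarrow> nat \<Rightarrow> real" where
  "tail_ratio d n s = (\<Prod>k=d..<n. (real d + real k - 2 * real s) / (real d + real k))"

lemma tail_ratio_nonneg: "s \<le> d \<Longrightarrow> 0 \<le> tail_ratio d n s"
  unfolding tail_ratio_def by (intro prod_nonneg) (auto intro!: divide_nonneg_nonneg)

text \<open>
  Passing from \<open>s\<close> to \<open>s + 1\<close> shifts the numerators by two places, so only the two
  numerators at either end of the product change.
\<close>
lemma tail_ratio_Suc:
  assumes "1 \<le> d" and "d \<le> n"
  shows "tail_ratio d n (Suc s) * ((real n + real d - 1 - 2 * real s) * (real n + real d - 2 - 2 * real s)) =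
    tail_ratio d n s * ((2 * real d - 1 - 2 * real s) * (2 * real d - 2 - 2 * real s))"
  using assms(2)
proof (induction n rule: dec_induct)
  case base
  show ?case by (simp add: tail_ratio_def)
next
  case (step n)
  have S: "tail_ratio d (Suc n) s = tail_ratio d n s * ((real d + real n - 2 * real s) / (real d + real n))" for s
    using step by (simp add: tail_ratio_def)
  have "tail_ratio d (Suc n) (Suc s) *
      ((real (Suc n) + real d - 1 - 2 * real s) * (real (Suc n) + real d - 2 - 2 * real s)) =
      tail_ratio d n (Suc s) * ((real n + real d - 1 - 2 * real s) * (real n + real d - 2 - 2 * real s)) *
      ((real d + real n - 2 * real s) / (real d + real n))"
    unfolding S by (simp add: field_simps)
  then show ?case unfolding step.IH by (simp add: S mult_ac)
qed

text \<open>
  Each step from \<open>s\<close> to \<open>s + 1\<close> multiplies the left-hand side by \<open>(n - s) / (s + 1)\<close> and by the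
  quotient \<open>Y / (X1 * X2)\<close> from the telescoping identity. Here \<open>n - s \<le> X1\<close>, and \<open>Y \<le> X2\<close>
  is exactly the hypothesis on \<open>n\<close> when \<open>s = 0\<close> and is weaker for larger \<open>s\<close>; what remains is at
  most \<open>1 / (s + 1)\<close>.
\<close>
lemma binomial_tail_ratio_le:
  assumes n: "4 * real d ^ 2 - 7 * real d + 4 \<le> real n" and d: "1 \<le> d" and s: "s < d"
  shows "real (n choose s) * tail_ratio d n s \<le> 1 / fact s"
  using s
proof (induction s)
  case 0
  have "tail_ratio d n 0 = 1"
    unfolding tail_ratio_def using d by (intro prod.neutral) auto
  then show ?case by simp
next
  case (Suc s)
  have r: "1 \<le> real d" "real s + 2 \<le> real d" "0 \<le> real s" using Suc.prems by linarith+
  have sq: "real d * real d \<ge> 2 * real d" using r by (intro mult_right_mono) auto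
  have nd: "real d \<le> real n" using n sq r unfolding power2_eq_square by linarith
  then have dn: "d \<le> n" by simp
  define X1 where "X1 = real n + real d - 1 - 2 * real s"
  define X2 where "X2 = real n + real d - 2 - 2 * real s"
  define Y where "Y = (2 * real d - 1 - 2 * real s) * (2 * real d - 2 - 2 * real s)"
  have Y: "Y \<le> X2"
  proof -
    have "Y \<le> (2 * real d - 1) * (2 * real d - 2 - 2 * real s)"
      unfolding Y_def using r by (intro mult_right_mono) auto
    also have "\<dots> = 4 * real d ^ 2 - 6 * real d + 2 - 2 * ((2 * real d - 1) * real s)"
      by (simp add: algebra_simps power2_eq_square)
    also have "\<dots> \<le> 4 * real d ^ 2 - 6 * real d + 2 - 2 * real s"
      using r mult_right_mono[of 1 "2 * real d - 1" "real s"] by simp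
    also have "\<dots> \<le> X2" using n unfolding X2_def by simp
    finally show ?thesis .
  qed
  have Y0: "0 \<le> Y" unfolding Y_def using r by simp
  have X1: "real n - real s \<le> X1" "0 < X1" and X2: "0 < X2"
    unfolding X1_def X2_def using r nd by linarith+
  have C: "real (n choose Suc s) * real (Suc s) = real (n choose s) * (real n - real s)"
  proof -
    have "s \<le> n" using Suc.prems dn by simp
    have "(n choose Suc s) * Suc s = (n choose s) * (n - s)"
      using binomial_absorb_comp[of n s] binomial_absorption[of s "n"] by (simp add: mult.commute)
    then have "real ((n choose Suc s) * Suc s) = real ((n choose s) * (n - s))"
      by (simp only:)
    then show ?thesis by (simp only: of_nat_mult of_nat_diff[OF \<open>s \<le> n\<close>])
  qed
  have T: "0 \<le> real (n choose s) * tail_ratio d n s"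
    using Suc.prems by (intro mult_nonneg_nonneg tail_ratio_nonneg) auto
  have "(real (n choose Suc s) * tail_ratio d n (Suc s) * real (Suc s)) * (X1 * X2) =
      (real (n choose Suc s) * real (Suc s)) * (tail_ratio d n (Suc s) * (X1 * X2))"
    by (simp add: mult_ac)
  also have "\<dots> = (real (n choose s) * tail_ratio d n s) * ((real n - real s) * Y)"
    unfolding C X1_def X2_def Y_def tail_ratio_Suc[OF d dn] by (simp add: mult_ac)
  also have "\<dots> \<le> (real (n choose s) * tail_ratio d n s) * (X1 * X2)"
    using T Y Y0 X1 by (intro mult_left_mono mult_mono) auto
  finally have "real (n choose Suc s) * tail_ratio d n (Suc s) * real (Suc s) \<le> real (n choose s) * tail_ratio d n s"
    using X1 X2 by (simp del: of_nat_Suc binomial_Suc_Suc)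
  also have "\<dots> \<le> 1 / fact s" using Suc by simp
  finally have "real (n choose Suc s) * tail_ratio d n (Suc s) \<le> 1 / fact s / real (Suc s)"
    by (simp only: pos_le_divide_eq of_nat_0_less_iff zero_less_Suc)
  also have "\<dots> = 1 / fact (Suc s)"
    by (simp add: mult.commute)
  finally show ?case .
qed

text \<open>
  The reciprocal of the base is \<open>1 + 1 / (d - 1)\<close>, and Bernoulli's inequality bounds its power from
  below by two.
\<close>
lemma one_minus_inverse_power_le_half:
  assumes "2 \<le> d"
  shows "(1 - 1 / real d) ^ (d - 1) \<le> 1 / 2"
proof -
  have "2 \<le> (1 + 1 / (real d - 1)) ^ (d - 1)"
  proof -
    have "0 \<le> 1 / (real d - 1)" using assms by simp
    then have "- 1 \<le> 1 / (real d - 1)" by linarith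
    from Bernoulli_inequality[OF this, of "d - 1"] show ?thesis
      using assms by (simp add: of_nat_diff)
  qed
  moreover have "(1 - 1 / real d) * (1 + 1 / (real d - 1)) = 1"
    using assms by (simp add: field_simps)
  then have "(1 - 1 / real d) ^ (d - 1) * (1 + 1 / (real d - 1)) ^ (d - 1) = 1"
    by (metis power_mult_distrib power_one)
  moreover have "0 \<le> (1 - 1 / real d) ^ (d - 1)" using assms by simp
  ultimately show ?thesis
    using mult_left_mono[of 2 "(1 + 1 / (real d - 1)) ^ (d - 1)" "(1 - 1 / real d) ^ (d - 1)"]
    by simp
qed

text \<open>
  Both binomial coefficients are products over \<open>1 \<le> k < n\<close>, compared factor by factor. The indices
  below \<open>d\<close> account for \<open>1 / 2\<close> and the remaining ones for \<open>tail_ratio\<close>.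
\<close>
lemma gbinomial_term_bound:
  fixes z :: complex
  assumes z: "Re z \<ge> 1" and s: "1 \<le> s" "s < d" and n: "d \<le> n"
  shows "norm (((of_nat d - of_nat s) * z + of_nat (n - 1) - of_nat s) gchoose (n - 1)) \<le>
    1 / 2 * tail_ratio d n s * norm ((of_nat d * z + of_nat (n - 1)) gchoose (n - 1))"
proof -
  have G: "(w + of_nat (n - 1)) gchoose (n - 1) = (\<Prod>k=1..<n. w + of_nat k) / fact (n - 1)" for w :: complex
  proof -
    have "pochhammer (w + 1) (n - 1) = (\<Prod>k=1..<n. w + of_nat k)"
      unfolding pochhammer_prod using s n
      by (intro prod.reindex_bij_witness[of _ "\<lambda>k. k - 1" Suc]) auto
    then show ?thesis by (simp add: gbinomial_pochhammer')
  qed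
  define c where "c k = (if k < d then 1 - 1 / real d else (real d + real k - 2 * real s) / (real d + real k))" for k
  have "norm (\<Prod>k=1..<n. (of_nat d - of_nat s) * z - of_nat s + of_nat k) \<le>
      (\<Prod>k=1..<n. c k * norm (of_nat d * z + of_nat k))"
    unfolding prod_norm[symmetric] c_def
    using factor_ratio_small_index[OF z s] factor_ratio_large_index[OF z s(2)]
    by (intro prod_mono) auto
  also have "\<dots> = (\<Prod>k=1..<n. c k) * norm (\<Prod>k=1..<n. of_nat d * z + of_nat k)"
    by (simp add: prod.distrib prod_norm)
  also have "(\<Prod>k=1..<n. c k) = (\<Prod>k=1..<d. c k) * (\<Prod>k=d..<n. c k)"
    using s n by (intro prod.atLeastLessThan_concat[symmetric]) auto
  also have "(\<Prod>k=1..<d. c k) = (1 - 1 / real d) ^ (d - 1)"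
    by (simp add: c_def)
  also have "(\<Prod>k=d..<n. c k) = tail_ratio d n s"
    by (simp add: c_def tail_ratio_def)
  also have "(1 - 1 / real d) ^ (d - 1) * tail_ratio d n s * norm (\<Prod>k=1..<n. of_nat d * z + of_nat k) \<le>
      1 / 2 * tail_ratio d n s * norm (\<Prod>k=1..<n. of_nat d * z + of_nat k)"
    using s tail_ratio_nonneg[of s d n] one_minus_inverse_power_le_half[of d]
    by (intro mult_right_mono) auto
  finally have "norm (\<Prod>k=1..<n. (of_nat d - of_nat s) * z - of_nat s + of_nat k) / fact (n - 1) \<le>
      1 / 2 * tail_ratio d n s * norm (\<Prod>k=1..<n. of_nat d * z + of_nat k) / fact (n - 1)"
    by (rule divide_right_mono) simp
  then show ?thesis
    using G[of "(of_nat d - of_nat s) * z - of_nat s"] G[of "of_nat d * z"]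
    by (simp add: norm_divide algebra_simps)
qed

lemma inverse_fact_le_half_power: "1 / fact (Suc s) \<le> (1 / 2 :: real) ^ s"
proof (induction s)
  case (Suc s)
  have "1 / fact (Suc (Suc s)) = (1 / real (Suc (Suc s))) * (1 / fact (Suc s) :: real)"
    by simp
  also have "\<dots> \<le> 1 / 2 * (1 / 2) ^ s"
    using Suc by (intro mult_mono) auto
  finally show ?case by simp
qed simp

text \<open>
  At a root with real part at least one, \<open>T 0\<close> would be the negative of the sum of the other terms,
  whose modulus is strictly smaller. The bound on \<open>n\<close> is the one under which consecutive bounds
  for the terms shrink fast enough.
\<close>
lemma hypersimplex_ehrhart_root_Re_less_1:
  fixes z :: complex
  assumes d: "1 \<le> d" and n: "4 * real d ^ 2 - 7 * real d + 4 \<le> real CARD('n)"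
    and root: "poly (ehrhart_polynomial (hypersimplex d :: (real ^ 'n) set)) z = 0"
  shows "Re z < 1"
proof (rule ccontr)
  let ?n = "CARD('n)"
  assume "\<not> Re z < 1"
  then have z: "Re z \<ge> 1" by simp
  have dn: "d \<le> ?n"
  proof -
    have "0 \<le> 4 * (real d - 1) ^ 2" by simp
    then show ?thesis using n by (simp add: power2_eq_square algebra_simps)
  qed
  define T where "T s = (-1) ^ s * of_nat (?n choose s) *
       (((of_nat d - of_nat s) * z + of_nat (?n - 1) - of_nat s) gchoose (?n - 1))" for s
  have T0: "T 0 = (of_nat d * z + of_nat (?n - 1)) gchoose (?n - 1)"
    by (simp add: T_def)
  have "T 0 \<noteq> 0"
  proof
    assume "T 0 = 0"
    then obtain i where i: "i < ?n - 1" "of_nat d * z + of_nat (?n - 1) - of_nat i = 0"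
      unfolding T0 gbinomial_prod_rev by auto
    then have "Re (of_nat d * z + of_nat (?n - 1) - of_nat i) = 0" by (metis zero_complex.sel(1))
    then have "real d * Re z + real (?n - 1) - real i = 0" by simp
    moreover have "real i < real (?n - 1)" using i by simp
    moreover have "0 \<le> real d * Re z" using z by simp
    ultimately show False by linarith
  qed
  have bound: "norm (T s) \<le> (1 / 2) ^ s * norm (T 0)" if s: "s \<in> {1..<d}" for s
  proof -
    obtain t where t: "s = Suc t" using s by (cases s) auto
    have "norm (T s) = real (?n choose s) *
        norm (((of_nat d - of_nat s) * z + of_nat (?n - 1) - of_nat s) gchoose (?n - 1))"
      unfolding T_def by (simp add: norm_mult norm_power)
    also have "\<dots> \<le> real (?n choose s) * (1 / 2 * tail_ratio d ?n s * norm (T 0))"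
      unfolding T0 using s dn by (intro mult_left_mono gbinomial_term_bound z) auto
    also have "\<dots> = 1 / 2 * (real (?n choose s) * tail_ratio d ?n s) * norm (T 0)"
      by simp
    also have "\<dots> \<le> 1 / 2 * (1 / 2) ^ t * norm (T 0)"
    proof -
      have "real (?n choose s) * tail_ratio d ?n s \<le> (1 / 2) ^ t"
        using binomial_tail_ratio_le[OF n d, of s] inverse_fact_le_half_power[of t] s
        unfolding t by (meson atLeastLessThan_iff order_trans)
      then show ?thesis
        by (intro mult_right_mono mult_left_mono) auto
    qed
    finally show ?thesis by (simp add: t)
  qed
  have half: "(\<Sum>s\<in>{1..<d}. (1 / 2 :: real) ^ s) = 1 - 2 * (1 / 2) ^ d"
    using d by (induction d rule: dec_induct) simp_all
  have "0 = (\<Sum>s<d. T s)"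
    using root unfolding poly_hypersimplex_ehrhart_polynomial[OF d dn] T_def by simp
  also have "\<dots> = T 0 + (\<Sum>s\<in>{1..<d}. T s)"
    using d by (simp add: lessThan_atLeast0 sum.atLeast_Suc_lessThan)
  finally have "norm (T 0) = norm (\<Sum>s\<in>{1..<d}. T s)"
    by (metis add_eq_0_iff norm_minus_cancel)
  also have "\<dots> \<le> (\<Sum>s\<in>{1..<d}. (1 / 2) ^ s * norm (T 0))"
    by (intro sum_norm_le bound)
  also have "\<dots> = (1 - 2 * (1 / 2) ^ d) * norm (T 0)"
    by (simp only: half flip: sum_distrib_right)
  also have "\<dots> < 1 * norm (T 0)"
    using \<open>T 0 \<noteq> 0\<close> by (intro mult_strict_right_mono) auto
  finally show False by simp
qed

theorem theorem3p1:
  fixes d :: nat and a :: complex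
  assumes "d \<ge> 4"
    and "int CARD('n::finite) \<ge> 6 * (int d)\<^sup>2 - 16 * int d + 13"
    and "poly (ehrhart_polynomial (hypersimplex d :: (real ^ 'n) set)) a = 0"
  shows "Re a < 1"
proof (rule hypersimplex_ehrhart_root_Re_less_1[OF _ _ assms(3)])
  show "1 \<le> d" using assms(1) by simp
  have "real_of_int (int CARD('n)) \<ge> real_of_int (6 * (int d)\<^sup>2 - 16 * int d + 13)"
    using assms(2) by (simp only: of_int_le_iff)
  then have "real CARD('n) \<ge> 6 * real d ^ 2 - 16 * real d + 13"
    by simp
  \<comment> \<open>This product is the excess of \<open>6 * d\<^sup>2 - 16 * d + 13\<close> over \<open>4 * d\<^sup>2 - 7 * d + 4\<close>.\<close>
  moreover have "0 \<le> (2 * real d - 3) * (real d - 3)"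
    using assms(1) by simp
  ultimately show "4 * real d ^ 2 - 7 * real d + 4 \<le> real CARD('n)"
    by (simp add: power2_eq_square algebra_simps)
qed

end
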